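(* Let $x\in(0,1)$, let $n\in\mathbb{N}$, and set $m=\sum_{j=0}^{n-1}1_{[0,\frac13)}\left(R^j(x)\right)$. Then there exist $a_1,\dots,a_{n+m}\in\{0,2\}$ and $\rho_1,\dots,\rho_{n+m}\in\{-1,+1\}$ such that $a_1=2$, such that $a_i=0$ implies $a_{i-1}=2$ and $\rho_i=+1$ for $2\le i\le n+m$, and such that $$x=\frac{1}{a_1+\displaystyle\frac{\rho_1}{a_2+\ddots+\displaystyle\frac{\rho_{n+m-1}}{a_{n+m}+\rho_{n+m}R^n(x)}}}.$$
   Context: $\mathbb{N}=\{1,2,\dots\}$. The Romik map $R:[0,1]\to[0,1]$ is defined by $R(x)=\frac{x}{1-2x}$ for $0\le x\le \frac13$, $R(x)=\frac1x-2$ for $\frac13\le x\le\frac12$, and $R(x)=2-\frac1x$ for $\frac12\le x\le 1$; $R^j$ is its $j$-fold iterate ($R^0$ the identity) and $1_{[0,\frac13)}$ is the indicator function of $[0,\frac13)$. The continued fraction is evaluated with the conventions $1/0=\infty$, $c+\infty=\infty$ for $c\in\mathbb{R}$, and $\pm1/\infty=0$; these are only needed when $R^n(x)=0$. *)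

theory Defs
  imports "HOL-Library.Extended_Real" "HOL-Library.Indicator_Function"
begin

text \<open>Only the values on \<open>{0..1}\<close> matter; adjacent branches agree at 1/3 and at 1/2.\<close>

definition romik :: "real \<Rightarrow> real" where
  "romik x = (if x \<le> 1/3 then x / (1 - 2 * x)
              else if x \<le> 1/2 then 1 / x - 2
              else 2 - 1 / x)"

lemma romik_branches:
  "0 \<le> x \<Longrightarrow> x \<le> 1/3 \<Longrightarrow> romik x = x / (1 - 2 * x)"
  "1/3 \<le> x \<Longrightarrow> x \<le> 1/2 \<Longrightarrow> romik x = 1 / x - 2"
  "1/2 \<le> x \<Longrightarrow> x \<le> 1 \<Longrightarrow> romik x = 2 - 1 / x"
proof -
  show "0 \<le> x \<Longrightarrow> x \<le> 1/3 \<Longrightarrow> romik x = x / (1 - 2 * x)"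
    by (simp add: romik_def)
  show "1/3 \<le> x \<Longrightarrow> x \<le> 1/2 \<Longrightarrow> romik x = 1 / x - 2"
    by (cases "x = 1/3", hypsubst) (simp_all add: romik_def)
  show "1/2 \<le> x \<Longrightarrow> x \<le> 1 \<Longrightarrow> romik x = 2 - 1 / x"
    by (cases "x = 1/2", hypsubst) (simp_all add: romik_def)
qed

lemma romik_range:
  assumes "x \<in> {0..1}"
  shows "romik x \<in> {0..1}"
  using assms by (auto simp: romik_def field_simps)

text \<open>
  \<open>cf_denom a \<rho> i k t\<close> is the \<open>(k+1)\<close>-storey expression
  \<open>a\<^sub>i + \<rho>\<^sub>i / (a\<^sub>i\<^sub>+\<^sub>1 + \<rho>\<^sub>i\<^sub>+\<^sub>1 / (\<dots> / (a\<^sub>i\<^sub>+\<^sub>k + \<rho>\<^sub>i\<^sub>+\<^sub>k t)))\<close>.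
  It is evaluated in \<^typ>\<open>ereal\<close>, where \<open>1 / 0 = \<infinity>\<close>, \<open>c + \<infinity> = \<infinity>\<close> for real \<open>c\<close>, and
  \<open>\<plusminus>1 / \<infinity> = 0\<close>. There \<open>-1 / 0 = -\<infinity>\<close>; the sign of the infinity is
  immaterial, since \<open>c + (-\<infinity>) = -\<infinity>\<close> and \<open>\<plusminus>1 / (-\<infinity>) = 0\<close>.
\<close>

primrec cf_denom :: "(nat \<Rightarrow> real) \<Rightarrow> (nat \<Rightarrow> real) \<Rightarrow> nat \<Rightarrow> nat \<Rightarrow> real \<Rightarrow> ereal" where
  "cf_denom a \<rho> i 0 t = ereal (a i + \<rho> i * t)"
| "cf_denom a \<rho> i (Suc k) t = ereal (a i) + ereal (\<rho> i) / cf_denom a \<rho> (Suc i) k t"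

lemma ereal_cf_conventions:
  "1 / (0::ereal) = \<infinity>"
  "ereal c + \<infinity> = \<infinity>"
  "1 / (\<infinity>::ereal) = 0" "-1 / (\<infinity>::ereal) = 0"
  "-1 / (0::ereal) = -\<infinity>"
  "ereal c + (-\<infinity>) = -\<infinity>"
  "1 / (-\<infinity>::ereal) = 0" "-1 / (-\<infinity>::ereal) = 0"
  by (simp_all add: divide_ereal_def)

end

theory Submission
  imports Defs
begin

text \<open>
  Inverting each branch of the Romik map \<open>R\<close> on \<open>{0..1}\<close> gives one or two storeys of a continued
  fraction:
  \<open>y = 1 / (2 + 1 / (0 + R y))\<close> on \<open>{0..<1/3}\<close>, \<open>y = 1 / (2 + R y)\<close> on \<open>{1/3..1/2}\<close> and
  \<open>y = 1 / (2 - R y)\<close> on \<open>{1/2..1}\<close>. So every step of the orbit of \<open>x\<close> contributes one storey, and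
  a second one exactly when the orbit point lies in \<open>{0..<1/3}\<close>, which accounts for the length
  \<open>n + m\<close>. Substituting these identities into each other along the orbit yields the expansion
  (\<open>cf_value_romik_digits\<close>). The digit 0 occurs only as the second storey of the first branch, hence
  right after a 2 and with sign \<open>+1\<close>; this property survives concatenation of blocks
  (\<open>admissible_append\<close>).

  An infinite value can occur only inside the two-storey block, when \<open>R y = 0\<close>; there
  \<open>1 / (2 + 1 / 0) = 0\<close> is the correct value, because then \<open>y = 0\<close>.
\<close>

text \<open>
  The continued fraction \<open>1 / (a\<^sub>1 + \<rho>\<^sub>1 (1 / (a\<^sub>2 + \<rho>\<^sub>2 (\<dots> v))))\<close> whose storeys are listed, from the
  outermost inwards, as pairs \<open>(a\<^sub>i, \<rho>\<^sub>i)\<close>. The empty list leaves \<open>v\<close> unchanged, so that appending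
  lists composes the corresponding maps.
\<close>

primrec cf_value :: "(real \<times> real) list \<Rightarrow> ereal \<Rightarrow> ereal" where
  "cf_value [] v = v"
| "cf_value (d # ds) v = 1 / (ereal (fst d) + ereal (snd d) * cf_value ds v)"

lemma cf_value_append: "cf_value (ds @ es) v = cf_value ds (cf_value es v)"
  by (induction ds) simp_all

lemma inverse_cf_denom:
  assumes "\<And>j. j < length ds \<Longrightarrow> a (i + j) = fst (ds ! j) \<and> \<rho> (i + j) = snd (ds ! j)"
    and "ds \<noteq> []"
  shows "1 / cf_denom a \<rho> i (length ds - 1) t = cf_value ds (ereal t)"
  using assms
proof (induction ds arbitrary: i)
  case Nil
  then show ?case by simp
next
  case (Cons d ds)
  have head: "a i = fst d" "\<rho> i = snd d"
    using Cons.prems(1)[of 0] by simp_all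
  show ?case
  proof (cases "ds = []")
    case True
    then show ?thesis using head by simp
  next
    case False
    then obtain k where k: "length ds = Suc k"
      by (cases ds) simp_all
    have "1 / cf_denom a \<rho> (Suc i) (length ds - 1) t = cf_value ds (ereal t)"
    proof (rule Cons.IH)
      show "a (Suc i + j) = fst (ds ! j) \<and> \<rho> (Suc i + j) = snd (ds ! j)"
        if "j < length ds" for j
        using Cons.prems(1)[of "Suc j"] that by simp
    qed (fact False)
    then show ?thesis
      using head k by (simp add: divide_ereal_def)
  qed
qed

text \<open>
  Digits are 0 or 2, signs are \<open>\<plusminus>1\<close>, and a digit 0 carries the sign \<open>+1\<close> and follows a digit 2.
  In particular the first digit, if there is one, is 2.
\<close>

definition admissible :: "(real \<times> real) list \<Rightarrow> bool" where
  "admissible ds \<longleftrightarrow> (\<forall>i < length ds.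
     fst (ds ! i) \<in> {0, 2} \<and> snd (ds ! i) \<in> {-1, 1} \<and>
     (fst (ds ! i) = 0 \<longrightarrow> 0 < i \<and> fst (ds ! (i - 1)) = 2 \<and> snd (ds ! i) = 1))"

lemma admissible_append:
  assumes ds: "admissible ds" and es: "admissible es"
  shows "admissible (ds @ es)"
  unfolding admissible_def
proof (intro allI impI)
  fix i
  assume i: "i < length (ds @ es)"
  show "fst ((ds @ es) ! i) \<in> {0, 2} \<and> snd ((ds @ es) ! i) \<in> {-1, 1} \<and>
     (fst ((ds @ es) ! i) = 0 \<longrightarrow>
        0 < i \<and> fst ((ds @ es) ! (i - 1)) = 2 \<and> snd ((ds @ es) ! i) = 1)"
  proof (cases "i < length ds")
    case True
    then show ?thesis
      using ds by (auto simp: admissible_def nth_append)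
  next
    case False
    then obtain j where j: "i = length ds + j"
      using le_Suc_ex not_less by blast
    with i have "j < length es" by simp
    moreover have "(ds @ es) ! (i - 1) = es ! (j - 1)" if "0 < j"
    proof -
      have "i - 1 = length ds + (j - 1)"
        using that j by simp
      then show ?thesis
        by (simp only: nth_append_length_plus)
    qed
    ultimately show ?thesis
      using es j unfolding admissible_def by (auto simp: nth_append)
  qed
qed

text \<open>The storeys contributed by one application of the Romik map at \<open>y\<close>.\<close>

definition romik_block :: "real \<Rightarrow> (real \<times> real) list" where
  "romik_block y = (if y < 1/3 then [(2, 1), (0, 1)] else if y \<le> 1/2 then [(2, 1)] else [(2, -1)])"

lemma admissible_romik_block: "admissible (romik_block y)"
  by (auto simp: admissible_def romik_block_def less_Suc_eq)

lemma length_romik_block: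
  assumes "0 \<le> y"
  shows "length (romik_block y) = 1 + indicator {0..<1/3} y"
  using assms by (simp add: romik_block_def indicator_def)

lemma cf_value_romik_block:
  assumes "y \<in> {0..1}"
  shows "cf_value (romik_block y) (ereal (romik y)) = ereal y"
proof -
  consider "y = 0" | "0 < y" "y < 1/3" | "1/3 \<le> y" "y \<le> 1/2" | "1/2 < y" "y \<le> 1"
    using assms by fastforce
  then show ?thesis
  proof cases
    case 1
    then show ?thesis
      by (simp add: romik_block_def romik_def divide_ereal_def)
  next
    case 2
    have "2 + (1 - 2 * y) / y = 1 / y"
      using 2 by (simp add: field_simps)
    then show ?thesis
      using 2 by (simp add: romik_block_def romik_def one_ereal_def)
  next
    case 3
    then show ?thesis
      by (simp add: romik_block_def romik_branches(2) one_ereal_def)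
  next
    case 4
    then show ?thesis
      by (simp add: romik_block_def romik_def one_ereal_def)
  qed
qed

text \<open>The storeys contributed by the first \<open>n\<close> points of the orbit of \<open>x\<close>.\<close>

primrec romik_digits :: "nat \<Rightarrow> real \<Rightarrow> (real \<times> real) list" where
  "romik_digits 0 x = []"
| "romik_digits (Suc n) x = romik_digits n x @ romik_block ((romik ^^ n) x)"

lemma romik_funpow_range: "x \<in> {0..1} \<Longrightarrow> (romik ^^ n) x \<in> {0..1}"
proof (induction n)
  case (Suc n)
  then show ?case using romik_range by simp
qed simp

lemma admissible_romik_digits: "admissible (romik_digits n x)"
proof (induction n)
  case 0
  then show ?case by (simp add: admissible_def)
next
  case (Suc n)
  then show ?case by (simp add: admissible_append admissible_romik_block)
qed

lemma length_romik_digits: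
  assumes "x \<in> {0..1}"
  shows "length (romik_digits n x) = n + (\<Sum>j<n. indicator {0..<1/3} ((romik ^^ j) x))"
proof (induction n)
  case (Suc n)
  then show ?case
    using romik_funpow_range[OF assms, of n] by (simp add: length_romik_block)
qed simp

lemma cf_value_romik_digits:
  assumes "x \<in> {0..1}"
  shows "cf_value (romik_digits n x) (ereal ((romik ^^ n) x)) = ereal x"
proof (induction n)
  case (Suc n)
  then show ?case
    using cf_value_romik_block[OF romik_funpow_range[OF assms, of n]]
    by (simp add: cf_value_append)
qed simp

theorem theorem3p1:
  fixes x :: real and n m :: nat
  assumes "x \<in> {0<..<1}"
    and "n \<ge> 1"
    and "m = (\<Sum>j = 0..n - 1. indicator {0..<1/3} ((romik ^^ j) x))"
  shows "\<exists>a \<rho> :: nat \<Rightarrow> real.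
    (\<forall>i\<in>{1..n + m}. a i \<in> {0, 2} \<and> \<rho> i \<in> {-1, 1}) \<and>
    a 1 = 2 \<and>
    (\<forall>i\<in>{2..n + m}. a i = 0 \<longrightarrow> a (i - 1) = 2 \<and> \<rho> i = 1) \<and>
    ereal x = 1 / cf_denom a \<rho> 1 (n + m - 1) ((romik ^^ n) x)"
proof -
  define ds where "ds = romik_digits n x"
  \<comment> \<open>List positions start at 0, the digits \<open>a\<^sub>i\<close> at 1.\<close>
  define a where "a i = fst (ds ! (i - 1))" for i
  define \<rho> where "\<rho> i = snd (ds ! (i - 1))" for i
  have x: "x \<in> {0..1}"
    using assms(1) by simp
  have "{0..n - 1} = {..<n}"
    using assms(2) by auto
  then have len: "length ds = n + m"
    unfolding ds_def length_romik_digits[OF x] assms(3) by simp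
  have adm: "fst (ds ! i) \<in> {0, 2} \<and> snd (ds ! i) \<in> {-1, 1} \<and>
     (fst (ds ! i) = 0 \<longrightarrow> 0 < i \<and> fst (ds ! (i - 1)) = 2 \<and> snd (ds ! i) = 1)"
    if "i < n + m" for i
    using admissible_romik_digits[of n x] that len by (simp add: admissible_def flip: ds_def)
  have "a i \<in> {0, 2} \<and> \<rho> i \<in> {-1, 1}" if "i \<in> {1..n + m}" for i
    using adm[of "i - 1"] that by (auto simp: a_def \<rho>_def)
  moreover have "a 1 = 2"
    using adm[of 0] assms(2) by (auto simp: a_def)
  moreover have "a (i - 1) = 2 \<and> \<rho> i = 1" if "i \<in> {2..n + m}" "a i = 0" for i
    using adm[of "i - 1"] that by (auto simp: a_def \<rho>_def)
  moreover have "ereal x = 1 / cf_denom a \<rho> 1 (n + m - 1) ((romik ^^ n) x)"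
  proof -
    have "ds \<noteq> []"
      using len assms(2) by auto
    then have "1 / cf_denom a \<rho> 1 (length ds - 1) ((romik ^^ n) x)
        = cf_value ds (ereal ((romik ^^ n) x))"
      by (intro inverse_cf_denom) (simp_all add: a_def \<rho>_def)
    then show ?thesis
      using cf_value_romik_digits[OF x, of n] len by (simp add: ds_def)
  qed
  ultimately show ?thesis
    by blast
qed

end
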